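(* Let $q$ be a prime power and $n\ge2$ with $\gcd(q,n)=1$, and use the notation of the context. Let $K\subset\{1,\dots,r+s\}$ be a nonempty set, and let $C\subset\mathbb{F}_qD_n$ be the code such that $$\mathcal{P}(C)=\bigoplus_{j=1}^{r+s}B_j,\qquad B_j=\begin{cases}I_j(1,0),&j\in K,\ 1\le j\le\zeta(n)\\ I_j(\alpha_j+\alpha_j^{-1},\,2),&j\in K,\ \zeta(n)+1\le j\le r\\ I_j(-1,1),&j\in K,\ r+1\le j\le r+s\\ 0,&j\notin K.\end{cases}$$ Then $d(C)=2d(C_{ext})$.
   Context: $D_n=\langle a,b\mid a^n=1,\ b^2=1,\ bab=a^{-1}\rangle$ is the dihedral group of order $2n$, $\mathbb{F}_qD_n$ its group algebra; every element is uniquely $P(a)+bQ(a)$ with $P,Q\in\mathbb{F}_q[x]$ of degree less than $n$. A dihedral code is a left ideal of $\mathbb{F}_qD_n$. The Hamming weight of $u=\sum_g u_gg$ is $w(u)=|\{g\mid u_g\neq0\}|$, and $d(C)=\min_{0\ne c\in C}w(c)$. Let $\mathrm{pr}_a:\mathbb{F}_qD_n\to\mathbb{F}_q\langle a\rangle$, $P(a)+bQ(a)\mapsto P(a)$, where $\mathbb{F}_q\langle a\rangle\subset\mathbb{F}_qD_n$ is the group algebra of the cyclic subgroup generated by $a$. The exterior induced code is $C_{ext}=(\mathbb{F}_qD_n)\,\mathrm{pr}_a(C)$, the left ideal generated by $\mathrm{pr}_a(C)$. For $g\in\mathbb{F}_q[x]$ with $g(0)\neq0$ put $g^*(x)=x^{\deg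 g}g(x^{-1})$. Factor $x^n-1$ over $\mathbb{F}_q$ into (pairwise distinct) monic irreducible factors as $x^n-1=(f_1f_2\cdots f_r)(f_{r+1}f_{r+1}^*\cdots f_{r+s}f_{r+s}^* )$, where $f_1=x-1$, $f_2=x+1$ if $n$ is even, $f_j^*=f_j$ for $1<j\le r$, and for $j>r$ the polynomials $f_j$ and $f_j^*$ have different roots (here the factor $f_j^*$, $j>r$, is normalized by a scalar to be monic). Let $\alpha_j$ be a root of $f_j$. Let $\zeta(n)=1$ if $n$ is odd, $\zeta(n)=2$ if $n$ is even. $\langle h\mid h^2\rangle$ is the cyclic group of order 2 generated by $h$. Put $F_j=\mathbb{F}_q$ for $1\le j\le\zeta(n)$, $F_j=\mathbb{F}_q[\alpha_j+\alpha_j^{-1}]$ for $\zeta(n)+1\le j\le r$, $F_j=\mathbb{F}_q[\alpha_j]$ for $r+1\le j\le r+s$. Put $A_j=\mathbb{F}_q\langle h\mid h^2\rangle$ for $1\le j\le\zeta(n)$ and $A_j=\mathrm{M}_2(F_j)$ for $\zeta(n)+1\le j\le r+s$. Define for $u=P(a)+bQ(a)$: $\gamma_1(u)=P(1)+Q(1)h$; $\gamma_2(u)=P(-1)+Q(-1)h$ (for $n$ even); for $j\ge\zeta(n)+1$, $\tau_j(u)=\begin{pmatrix}P(\alpha_j)&Q(\alpha_j^{-1})\\ Q(\alpha_j)&P(\alpha_j^{-1})\end{pmatrix}$; for $\zeta(n)+1\le j\le r$, $\sigma_j(X)=Z_j^{-1}XZ_j$ with $Z_j=\begin{pmatrix}1&-\alpha_j\\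 1&-\alpha_j^{-1}\end{pmatrix}$. Put $\mathcal{P}_j=\gamma_j$ for $j\le\zeta(n)$, $\mathcal{P}_j=\sigma_j\tau_j$ for $\zeta(n)+1\le j\le r$, $\mathcal{P}_j=\tau_j$ for $r+1\le j\le r+s$. It is known that $\mathcal{P}=\bigoplus_{j=1}^{r+s}\mathcal{P}_j:\mathbb{F}_qD_n\to\bigoplus_{j=1}^{r+s}A_j$ is an algebra isomorphism. For $x,y\in F_j$ put $I_j(x,y)=\mathbb{F}_q\langle h\mid h^2\rangle\left[(x+y)+(x-y)h\right]$ for $1\le j\le\zeta(n)$, and $I_j(x,y)=\left\{\begin{pmatrix}ky & -kx \\ ty & -tx\end{pmatrix}\mid k,t\in F_j\right\}$ for $\zeta(n)+1\le j\le r+s$. *)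

theory Defs
  imports
    "HOL-Analysis.Cartesian_Space"
    "HOL-Algebra.Elementary_Groups"
    "HOL-Algebra.Algebraic_Closure_Type"
    "HOL-Computational_Algebra.Polynomial"
begin

section \<open>Group algebras\<close>

text \<open>The algebra of a finite group \<open>G\<close>: functions supported on the carrier, under convolution.
  (The carrier sums make this the right notion for finite \<open>G\<close> only.)\<close>

definition group_algebra :: "('g, 'm) monoid_scheme \<Rightarrow> ('g \<Rightarrow> 'a::comm_ring_1) ring"
  where "group_algebra G =
    \<lparr> carrier = {u. \<forall>g. g \<notin> carrier G \<longrightarrow> u g = 0},
      monoid.mult = (\<lambda>u v g. \<Sum>x\<in>carrier G. \<Sum>y\<in>carrier G. if x \<otimes>\<^bsub>G\<^esub> y = g then u x * v y else 0),
      one = (\<lambda>g. if g = \<one>\<^bsub>G\<^esub> then 1 else 0),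
      zero = (\<lambda>g. 0),
      add = (\<lambda>u v g. u g + v g) \<rparr>"

definition hamming_weight :: "('g \<Rightarrow> 'a::zero) \<Rightarrow> nat"
  where "hamming_weight u = card {g. u g \<noteq> 0}"

definition min_distance :: "('g \<Rightarrow> 'a::zero) set \<Rightarrow> nat"
  where "min_distance C = Min (hamming_weight ` {c \<in> C. c \<noteq> (\<lambda>g. 0)})"

definition left_ideal :: "'r set \<Rightarrow> ('r, 'm) ring_scheme \<Rightarrow> bool"
  where "left_ideal I R \<longleftrightarrow>
    additive_subgroup I R \<and> (\<forall>x\<in>carrier R. \<forall>c\<in>I. x \<otimes>\<^bsub>R\<^esub> c \<in> I)"

definition left_ideal_gen :: "('r, 'm) ring_scheme \<Rightarrow> 'r set \<Rightarrow> 'r set"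
  where "left_ideal_gen R S = \<Inter>{I. left_ideal I R \<and> S \<subseteq> I}"

lemma group_algebra_ring:
  fixes G (structure)
  assumes "group G" and fin: "finite (carrier G)"
  shows "ring (group_algebra G :: ('g \<Rightarrow> 'a::comm_ring_1) ring)"
proof -
  interpret group G by fact
  let ?R = "group_algebra G :: ('g \<Rightarrow> 'a) ring"
  have delta: "(\<Sum>p\<in>carrier G. if a = p \<and> Q p then c else 0) = (if Q a then c else 0)"
    if "a \<in> carrier G" for a Q and c :: 'a
  proof -
    have "(\<Sum>p\<in>carrier G. if a = p \<and> Q p then c else 0) =
        (\<Sum>p\<in>carrier G. if a = p then if Q a then c else 0 else 0)"
      by (intro sum.cong) auto
    then show ?thesis using fin that by simp
  qed
  have assoc: "u \<otimes>\<^bsub>?R\<^esub> v \<otimes>\<^bsub>?R\<^esub> w = u \<otimes>\<^bsub>?R\<^esub> (v \<otimes>\<^bsub>?R\<^esub> w)" for u v w :: "'g \<Rightarrow> 'a"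
  proof
    fix g
    have "(u \<otimes>\<^bsub>?R\<^esub> v \<otimes>\<^bsub>?R\<^esub> w) g =
      (\<Sum>p\<in>carrier G. \<Sum>z\<in>carrier G. \<Sum>x\<in>carrier G. \<Sum>y\<in>carrier G.
         if x \<otimes> y = p \<and> p \<otimes> z = g then u x * v y * w z else 0)"
      unfolding group_algebra_def
      by (auto simp: sum_distrib_right intro!: sum.cong)
    also have "\<dots> = (\<Sum>z\<in>carrier G. \<Sum>x\<in>carrier G. \<Sum>y\<in>carrier G. \<Sum>p\<in>carrier G.
         if x \<otimes> y = p \<and> p \<otimes> z = g then u x * v y * w z else 0)"
      by (rule trans[OF sum.swap], rule sum.cong[OF refl], rule trans[OF sum.swap],
          rule sum.cong[OF refl], rule sum.swap)
    also have "\<dots> = (\<Sum>z\<in>carrier G. \<Sum>x\<in>carrier G. \<Sum>y\<in>carrier G.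
         if x \<otimes> y \<otimes> z = g then u x * v y * w z else 0)"
      using fin by (intro sum.cong refl) (simp add: delta)
    also have "\<dots> = (\<Sum>x\<in>carrier G. \<Sum>y\<in>carrier G. \<Sum>z\<in>carrier G.
         if x \<otimes> (y \<otimes> z) = g then u x * v y * w z else 0)"
      by (rule trans[OF sum.swap], rule sum.cong[OF refl], rule trans[OF sum.swap])
        (intro sum.cong refl, simp add: m_assoc)
    also have "\<dots> = (\<Sum>x\<in>carrier G. \<Sum>y\<in>carrier G. \<Sum>z\<in>carrier G. \<Sum>p\<in>carrier G.
         if y \<otimes> z = p \<and> x \<otimes> p = g then u x * v y * w z else 0)"
      using fin by (intro sum.cong refl) (simp add: delta)
    also have "\<dots> = (\<Sum>x\<in>carrier G. \<Sum>p\<in>carrier G. \<Sum>y\<in>carrier G. \<Sum>z\<in>carrier G.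
         if y \<otimes> z = p \<and> x \<otimes> p = g then u x * v y * w z else 0)"
      by (rule sum.cong[OF refl], rule sym, rule trans[OF sum.swap], rule sum.cong[OF refl], rule sum.swap)
    also have "\<dots> = (u \<otimes>\<^bsub>?R\<^esub> (v \<otimes>\<^bsub>?R\<^esub> w)) g"
      unfolding group_algebra_def
      by (auto simp: sum_distrib_left mult.assoc intro!: sum.cong)
    finally show "(u \<otimes>\<^bsub>?R\<^esub> v \<otimes>\<^bsub>?R\<^esub> w) g = (u \<otimes>\<^bsub>?R\<^esub> (v \<otimes>\<^bsub>?R\<^esub> w)) g" .
  qed
  have onel: "\<one>\<^bsub>?R\<^esub> \<otimes>\<^bsub>?R\<^esub> u = u" and oner: "u \<otimes>\<^bsub>?R\<^esub> \<one>\<^bsub>?R\<^esub> = u" if "u \<in> carrier ?R" for u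
  proof -
    have u0: "u g = 0" if "g \<notin> carrier G" for g
      using \<open>u \<in> carrier ?R\<close> that by (auto simp: group_algebra_def)
    show "\<one>\<^bsub>?R\<^esub> \<otimes>\<^bsub>?R\<^esub> u = u"
    proof
      fix g
      have "(\<one>\<^bsub>?R\<^esub> \<otimes>\<^bsub>?R\<^esub> u) g =
          (\<Sum>x\<in>carrier G. if x = \<one> then \<Sum>y\<in>carrier G. if y = g then u y else 0 else 0)"
        unfolding group_algebra_def by (auto intro!: sum.cong sum.neutral)
      then show "(\<one>\<^bsub>?R\<^esub> \<otimes>\<^bsub>?R\<^esub> u) g = u g" using fin u0 by simp
    qed
    show "u \<otimes>\<^bsub>?R\<^esub> \<one>\<^bsub>?R\<^esub> = u"
    proof
      fix g
      have "(u \<otimes>\<^bsub>?R\<^esub> \<one>\<^bsub>?R\<^esub>) g =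
          (\<Sum>x\<in>carrier G. \<Sum>y\<in>carrier G. if y = \<one> then if x = g then u x else 0 else 0)"
        unfolding group_algebra_def by (auto intro!: sum.cong)
      then show "(u \<otimes>\<^bsub>?R\<^esub> \<one>\<^bsub>?R\<^esub>) g = u g" using fin u0 by simp
    qed
  qed
  show ?thesis
  proof (intro ringI)
    show "abelian_group ?R"
    proof (intro abelian_groupI)
      fix u assume "u \<in> carrier ?R"
      then show "\<exists>v\<in>carrier ?R. v \<oplus>\<^bsub>?R\<^esub> u = \<zero>\<^bsub>?R\<^esub>"
        by (intro bexI[of _ "\<lambda>g. - u g"]) (auto simp: group_algebra_def)
    qed (auto simp: group_algebra_def add_ac)
    show "monoid ?R"
    proof (intro monoidI)
      fix u v assume "u \<in> carrier ?R" "v \<in> carrier ?R"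
      then show "u \<otimes>\<^bsub>?R\<^esub> v \<in> carrier ?R"
        by (auto simp: group_algebra_def intro!: sum.neutral)
    qed (use assoc onel oner in \<open>auto simp: group_algebra_def\<close>)
  qed (auto simp: group_algebra_def fun_eq_iff sum.distrib[symmetric] algebra_simps
      intro!: sum.cong)
qed


section \<open>The dihedral group\<close>

text \<open>The pair \<open>(e, i)\<close> with \<open>0 \<le> i < n\<close> stands for \<open>a\<^sup>i\<close> if \<open>e\<close> is false and for \<open>b a\<^sup>i\<close> if \<open>e\<close> is
  true; the product is computed from \<open>a\<^sup>i b = b a\<^sup>-\<^sup>i\<close>.\<close>

definition dihedral :: "nat \<Rightarrow> (bool \<times> int) monoid"
  where "dihedral n =
    \<lparr> carrier = UNIV \<times> {0..<int n},
      monoid.mult = (\<lambda>(e, i) (e', i'). (e \<noteq> e', ((if e' then - i else i) + i') mod int n)),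
      one = (False, 0) \<rparr>"

lemma dihedral_group:
  assumes "n > 0"
  shows "group (dihedral n)"
proof (intro groupI)
  fix x assume "x \<in> carrier (dihedral n)"
  then show "\<exists>y\<in>carrier (dihedral n). y \<otimes>\<^bsub>dihedral n\<^esub> x = \<one>\<^bsub>dihedral n\<^esub>"
    using assms
    by (intro bexI[of _ "(fst x, (if fst x then snd x else - snd x) mod int n)"])
      (auto simp: dihedral_def mod_simps)
qed (use assms in \<open>auto simp: dihedral_def mod_simps algebra_simps\<close>)

lemma dihedral_presentation:
  assumes "n \<ge> 2"
  defines "G \<equiv> dihedral n" and "a \<equiv> (False, 1)" and "b \<equiv> (True, 0)"
  shows "card (carrier G) = 2 * n"
    and "a \<in> carrier G" and "b \<in> carrier G"
    and "a [^]\<^bsub>G\<^esub> n = \<one>\<^bsub>G\<^esub>" and "b [^]\<^bsub>G\<^esub> (2::nat) = \<one>\<^bsub>G\<^esub>"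
    and "b \<otimes>\<^bsub>G\<^esub> a \<otimes>\<^bsub>G\<^esub> b = inv\<^bsub>G\<^esub> a"
    and "i < n \<Longrightarrow> a [^]\<^bsub>G\<^esub> i = (False, int i)"
    and "i < n \<Longrightarrow> b \<otimes>\<^bsub>G\<^esub> a [^]\<^bsub>G\<^esub> i = (True, int i)"
    and "generate G {a, b} = carrier G"
proof -
  interpret group G using dihedral_group[of n] assms by (simp add: G_def)
  show "card (carrier G) = 2 * n" by (simp add: G_def dihedral_def card_cartesian_product)
  show a: "a \<in> carrier G" and b: "b \<in> carrier G"
    using assms(1) by (auto simp: G_def dihedral_def a_def b_def)
  have pow: "a [^]\<^bsub>G\<^esub> k = (False, int k mod int n)" for k :: nat
    by (induction k) (auto simp: G_def dihedral_def a_def nat_pow_def mod_simps add.commute)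
  show "a [^]\<^bsub>G\<^esub> n = \<one>\<^bsub>G\<^esub>" by (simp add: pow) (simp add: G_def dihedral_def)
  show "b [^]\<^bsub>G\<^esub> (2::nat) = \<one>\<^bsub>G\<^esub>"
    by (simp add: numeral_2_eq_2 b) (simp add: G_def dihedral_def b_def)
  have "b \<otimes>\<^bsub>G\<^esub> a \<otimes>\<^bsub>G\<^esub> b \<otimes>\<^bsub>G\<^esub> a = \<one>\<^bsub>G\<^esub>"
    by (simp add: G_def dihedral_def a_def b_def mod_simps)
  then show "b \<otimes>\<^bsub>G\<^esub> a \<otimes>\<^bsub>G\<^esub> b = inv\<^bsub>G\<^esub> a"
    using a b by (metis inv_equality m_closed)
  show p: "a [^]\<^bsub>G\<^esub> i = (False, int i)" if "i < n" for i using that by (simp add: pow)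
  show q: "b \<otimes>\<^bsub>G\<^esub> a [^]\<^bsub>G\<^esub> i = (True, int i)" if "i < n" for i
    using that by (simp add: p) (simp add: G_def dihedral_def b_def)
  show "generate G {a, b} = carrier G"
  proof
    show "generate G {a, b} \<subseteq> carrier G" using a b by (intro generate_incl) auto
    have ga: "a [^]\<^bsub>G\<^esub> k \<in> generate G {a, b}" for k :: nat
      by (induction k) (auto intro: generate.intros)
    show "carrier G \<subseteq> generate G {a, b}"
    proof
      fix x assume "x \<in> carrier G"
      then obtain e i where x: "x = (e, int i)" "i < n"
        by (auto simp: G_def dihedral_def) (metis nonneg_int_cases of_nat_less_iff)
      show "x \<in> generate G {a, b}"
      proof (cases e)
        case True
        have "b \<otimes>\<^bsub>G\<^esub> a [^]\<^bsub>G\<^esub> i \<in> generate G {a, b}"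
          using ga by (auto intro: generate.intros)
        then show ?thesis using x q True by simp
      next
        case False
        then show ?thesis using x p ga[of i] by simp
      qed
    qed
  qed
qed

definition dihedral_algebra :: "nat \<Rightarrow> (bool \<times> int \<Rightarrow> 'a::comm_ring_1) ring"
  where "dihedral_algebra n = group_algebra (dihedral n)"

definition pr_a :: "(bool \<times> int \<Rightarrow> 'a::zero) \<Rightarrow> bool \<times> int \<Rightarrow> 'a"
  where "pr_a u = (\<lambda>(e, i). if e then 0 else u (e, i))"

definition exterior_code :: "nat \<Rightarrow> (bool \<times> int \<Rightarrow> 'a::comm_ring_1) set \<Rightarrow> (bool \<times> int \<Rightarrow> 'a) set"
  where "exterior_code n C = left_ideal_gen (dihedral_algebra n) (pr_a ` C)"

text \<open>The polynomials \<open>P\<close>, \<open>Q\<close> of degree less than \<open>n\<close> with \<open>u = P(a) + b Q(a)\<close>.\<close>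

definition P_poly :: "nat \<Rightarrow> (bool \<times> int \<Rightarrow> 'a::comm_ring_1) \<Rightarrow> 'a poly"
  where "P_poly n u = (\<Sum>i<n. monom (u (False, int i)) i)"

definition Q_poly :: "nat \<Rightarrow> (bool \<times> int \<Rightarrow> 'a::comm_ring_1) \<Rightarrow> 'a poly"
  where "Q_poly n u = (\<Sum>i<n. monom (u (True, int i)) i)"


section \<open>The factorization of \<open>x\<^sup>n - 1\<close>\<close>

definition zeta :: "nat \<Rightarrow> nat"
  where "zeta n = (if odd n then 1 else 2)"

definition ac_eval :: "'a::field poly \<Rightarrow> 'a alg_closure \<Rightarrow> 'a alg_closure"
  where "ac_eval p x = poly (map_poly to_ac p) x"

definition make_monic :: "'a::field poly \<Rightarrow> 'a poly"
  where "make_monic p = smult (inverse (lead_coeff p)) p"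

text \<open>Since \<^term>\<open>reflect_poly g\<close> is \<open>x\<^bsup>deg g\<^esup> g(x\<^sup>-\<^sup>1)\<close>, it is \<open>g\<^sup>*\<close>.\<close>

definition xn1_factorization :: "nat \<Rightarrow> (nat \<Rightarrow> 'a::field poly) \<Rightarrow> nat \<Rightarrow> nat \<Rightarrow> bool"
  where "xn1_factorization n f r s \<longleftrightarrow>
    zeta n \<le> r \<and>
    monom 1 n - 1 =
      (\<Prod>j\<in>{1..r}. f j) * (\<Prod>j\<in>{r+1..r+s}. f j * make_monic (reflect_poly (f j))) \<and>
    (\<forall>j\<in>{1..r+s}. irreducible (f j) \<and> lead_coeff (f j) = 1) \<and>
    (\<forall>j\<in>{r+1..r+s}. irreducible (make_monic (reflect_poly (f j)))) \<and>
    distinct (map f [1..<r+s+1] @ map (\<lambda>j. make_monic (reflect_poly (f j))) [r+1..<r+s+1]) \<and>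
    f 1 = [:-1, 1:] \<and>
    (even n \<longrightarrow> f 2 = [:1, 1:]) \<and>
    (\<forall>j. 1 < j \<and> j \<le> r \<longrightarrow> reflect_poly (f j) = f j) \<and>
    (\<forall>j\<in>{r+1..r+s}. \<nexists>x. ac_eval (f j) x = 0 \<and> ac_eval (reflect_poly (f j)) x = 0)"


section \<open>The decomposition of the dihedral group algebra\<close>

text \<open>The group algebra of \<open>\<langle>h | h\<^sup>2\<rangle>\<close>; in \<^term>\<open>integer_mod_group 2\<close> the generator \<open>h\<close> is \<open>1\<close>.\<close>

definition C2_algebra :: "(int \<Rightarrow> 'a::comm_ring_1) ring"
  where "C2_algebra = group_algebra (integer_mod_group 2)"

text \<open>The element \<open>c + d h\<close>.\<close>

definition C2_elem :: "'a::comm_ring_1 \<Rightarrow> 'a \<Rightarrow> int \<Rightarrow> 'a"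
  where "C2_elem c d = (\<lambda>g. if g = 0 then c else if g = 1 then d else 0)"

definition mat2 :: "'b::zero \<Rightarrow> 'b \<Rightarrow> 'b \<Rightarrow> 'b \<Rightarrow> 'b^2^2"
  where "mat2 a b c d = vector [vector [a, b], vector [c, d]]"

definition tau :: "nat \<Rightarrow> 'a::field alg_closure \<Rightarrow> (bool \<times> int \<Rightarrow> 'a) \<Rightarrow> 'a alg_closure^2^2"
  where "tau n x u = mat2
    (ac_eval (P_poly n u) x) (ac_eval (Q_poly n u) (inverse x))
    (ac_eval (Q_poly n u) x) (ac_eval (P_poly n u) (inverse x))"

definition sigma :: "'b::field \<Rightarrow> 'b^2^2 \<Rightarrow> 'b^2^2"
  where "sigma x M = (let Z = mat2 1 (- x) 1 (- inverse x) in matrix_inv Z ** M ** Z)"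

text \<open>The components \<open>\<P>\<^sub>j\<close>. The left summand of the codomain hosts the \<open>A\<^sub>j\<close> with \<open>j \<le> \<zeta>(n)\<close>,
  the right one those with \<open>j > \<zeta>(n)\<close>, as \<open>M\<^sub>2(F\<^sub>j)\<close> inside the matrices over the algebraic closure.
  An element of the direct sum is an extensional function on \<open>{1..r+s}\<close>.\<close>

definition decomp_comp :: "nat \<Rightarrow> nat \<Rightarrow> (nat \<Rightarrow> 'a::field alg_closure) \<Rightarrow> nat \<Rightarrow>
    (bool \<times> int \<Rightarrow> 'a) \<Rightarrow> (int \<Rightarrow> 'a) + ('a alg_closure^2^2)"
  where "decomp_comp n r \<alpha> j u =
    (if j = 1 then Inl (C2_elem (poly (P_poly n u) 1) (poly (Q_poly n u) 1))
     else if j \<le> zeta n then Inl (C2_elem (poly (P_poly n u) (- 1)) (poly (Q_poly n u) (- 1)))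
     else if j \<le> r then Inr (sigma (\<alpha> j) (tau n (\<alpha> j) u))
     else Inr (tau n (\<alpha> j) u))"

definition decomp :: "nat \<Rightarrow> nat \<Rightarrow> nat \<Rightarrow> (nat \<Rightarrow> 'a::field alg_closure) \<Rightarrow>
    (bool \<times> int \<Rightarrow> 'a) \<Rightarrow> nat \<Rightarrow> (int \<Rightarrow> 'a) + ('a alg_closure^2^2)"
  where "decomp n r s \<alpha> u = (\<lambda>j\<in>{1..r+s}. decomp_comp n r \<alpha> j u)"

text \<open>The subring \<open>\<F>\<^sub>q[x]\<close> of the algebraic closure.\<close>

definition adjoin :: "'a::field alg_closure \<Rightarrow> 'a alg_closure set"
  where "adjoin x = range (\<lambda>p. ac_eval p x)"

text \<open>\<open>F\<^sub>j\<close> for \<open>j > \<zeta>(n)\<close>; for \<open>j \<le> \<zeta>(n)\<close> the field \<open>F\<^sub>j\<close> is the type \<^typ>\<open>'a\<close> itself.\<close>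

definition F_field :: "nat \<Rightarrow> (nat \<Rightarrow> 'a::field alg_closure) \<Rightarrow> nat \<Rightarrow> 'a alg_closure set"
  where "F_field r \<alpha> j = (if j \<le> r then adjoin (\<alpha> j + inverse (\<alpha> j)) else adjoin (\<alpha> j))"

text \<open>\<open>I\<^sub>j(x, y)\<close> for \<open>j \<le> \<zeta>(n)\<close> and for \<open>j > \<zeta>(n)\<close> (with \<open>F = F\<^sub>j\<close>) respectively.\<close>

definition I_C2 :: "'a::comm_ring_1 \<Rightarrow> 'a \<Rightarrow> (int \<Rightarrow> 'a) set"
  where "I_C2 x y =
    {z \<otimes>\<^bsub>C2_algebra\<^esub> C2_elem (x + y) (x - y) | z. z \<in> carrier C2_algebra}"

definition I_mat :: "'b::field set \<Rightarrow> 'b \<Rightarrow> 'b \<Rightarrow> ('b^2^2) set"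
  where "I_mat F x y =
    {mat2 (k * y) (- (k * x)) (t * y) (- (t * x)) | k t. k \<in> F \<and> t \<in> F}"

end

theory Submission
  imports Defs
begin

text \<open>The ideals \<open>B\<^sub>j\<close> are chosen so that the code consists of elements of the form
  \<open>P(a)(1 + b) = P(a) + bP(a\<^sup>-\<^sup>1)\<close>. Let \<open>j \<in> K\<close>. For \<open>j \<le> \<zeta>(n)\<close>, \<open>I\<^sub>j(1, 0)\<close> is generated by \<open>1 + h\<close> and says
  \<open>P(\<plusminus>1) = Q(\<plusminus>1)\<close>. For \<open>j > \<zeta>(n)\<close>, membership in \<open>B\<^sub>j\<close> says that the two columns of \<open>\<tau>\<^sub>j(u)\<close> agree,
  that is \<open>P(\<alpha>\<^sub>j) = Q(\<alpha>\<^sub>j\<^sup>-\<^sup>1)\<close> and \<open>Q(\<alpha>\<^sub>j) = P(\<alpha>\<^sub>j\<^sup>-\<^sup>1)\<close>; for \<open>j \<le> r\<close> this passes through the conjugation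
  by \<open>Z\<^sub>j\<close> because \<open>(1, 1)Z\<^sub>j = (2, -(\<alpha>\<^sub>j + \<alpha>\<^sub>j\<^sup>-\<^sup>1))\<close> (\<open>sigma_mem_I_mat_imp_equal_columns\<close>). The zero
  components for \<open>j \<notin> K\<close> satisfy the same equations. So \<open>Q(x)\<close> and \<open>P(x\<^sup>-\<^sup>1)\<close> agree modulo every irreducible factor
  of \<open>x\<^sup>n - 1\<close>, and since these factors are distinct, \<open>Q(a) = P(a\<^sup>-\<^sup>1)\<close>
  (\<open>coeffs_symmetric_if_factor_roots\<close>).

  Let \<open>J = pr\<^sub>a(C)\<close>, an ideal of the cyclic group algebra. The weight of \<open>P(a) + bP(a\<^sup>-\<^sup>1)\<close> is twice the
  weight of \<open>P(a)\<close>, so \<open>d(C) = 2d(J)\<close>. On the other side the exterior code contains \<open>J\<close> and lies in \<open>J + bJ\<close>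
  (\<open>exterior_code_components\<close>), where the weight of \<open>x + by\<close> is \<open>w(x) + w(y)\<close>; hence
  \<open>d(C\<^sub>e\<^sub>x\<^sub>t) = d(J)\<close>. Both steps are combined in \<open>min_distance_symmetric_code\<close>. It remains to see that \<open>C\<close>
  is nonzero, which holds because \<open>K\<close> is nonempty and the ideals \<open>B\<^sub>j\<close> with \<open>j \<in> K\<close> are nonzero; for
  \<open>\<zeta>(n) < j \<le> r\<close> this uses \<open>\<alpha>\<^sub>j \<noteq> \<alpha>\<^sub>j\<^sup>-\<^sup>1\<close> (\<open>factor_root_neq_inverse\<close>).\<close>

section \<open>Evaluation in the algebraic closure\<close>

lemma ac_eval_pCons: "ac_eval (pCons a p) x = to_ac a + x * ac_eval p x"
  by (cases "p = 0 \<and> a = 0") (auto simp: ac_eval_def map_poly_pCons)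

lemma ac_eval_0 [simp]: "ac_eval 0 x = 0"
  by (simp add: ac_eval_def)

lemma ac_eval_1 [simp]: "ac_eval 1 x = 1"
  by (simp add: one_pCons ac_eval_pCons)

lemma ac_eval_add [simp]: "ac_eval (p + q) x = ac_eval p x + ac_eval q x"
  by (induction p q rule: poly_induct2) (simp_all add: ac_eval_pCons algebra_simps)

lemma ac_eval_smult [simp]: "ac_eval (smult c p) x = to_ac c * ac_eval p x"
  by (induction p) (simp_all add: ac_eval_pCons algebra_simps)

lemma ac_eval_mult [simp]: "ac_eval (p * q) x = ac_eval p x * ac_eval q x"
  by (induction p) (simp_all add: ac_eval_pCons algebra_simps)

lemma ac_eval_diff [simp]: "ac_eval (p - q) x = ac_eval p x - ac_eval q x"
  using ac_eval_add[of "p - q" q x] by (simp add: algebra_simps)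

lemma ac_eval_monom [simp]: "ac_eval (monom c i) x = to_ac c * x ^ i"
  by (induction i) (simp_all add: monom_0 monom_Suc ac_eval_pCons)

lemma ac_eval_sum [simp]: "ac_eval (\<Sum>i\<in>I. p i) x = (\<Sum>i\<in>I. ac_eval (p i) x)"
  by (induction I rule: infinite_finite_induct) auto

lemma ac_eval_to_ac: "ac_eval p (to_ac c) = to_ac (poly p c)"
  by (induction p) (simp_all add: ac_eval_pCons)

text \<open>This is what makes the two factors \<open>f\<^sub>j\<close> and \<open>f\<^sub>j\<^sup>*\<close> correspond to the two evaluation points
  \<open>\<alpha>\<^sub>j\<close> and \<open>\<alpha>\<^sub>j\<^sup>-\<^sup>1\<close> that occur in \<open>\<tau>\<^sub>j\<close>.\<close>
lemma ac_eval_reflect_inverse: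
  assumes "ac_eval p x = 0" "x \<noteq> 0"
  shows "ac_eval (reflect_poly p) (inverse x) = 0"
proof -
  have "map_poly to_ac (reflect_poly p) = reflect_poly (map_poly to_ac p)"
    by (rule poly_eqI) (auto simp: coeff_map_poly coeff_reflect_poly degree_map_poly)
  then show ?thesis
    using assms poly_reflect_poly_nz[of "inverse x" "map_poly to_ac p"] by (simp add: ac_eval_def)
qed

text \<open>A polynomial \<open>g\<close> of least degree with root \<open>x\<close> divides every polynomial with root \<open>x\<close> (otherwise
  a remainder would be smaller). So \<open>g\<close> divides \<open>p\<close>, is not a unit, and therefore is associated
  to \<open>p\<close>.\<close>
lemma irreducible_dvd_if_root:
  fixes p q :: "'a::field poly"
  assumes p: "irreducible p" "ac_eval p x = 0" and q: "ac_eval q x = 0"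
  shows "p dvd q"
proof -
  define V where "V = (\<lambda>g. g \<noteq> 0 \<and> ac_eval g x = 0)"
  have "V p" using p by (auto simp: V_def)
  then obtain g where g: "V g" and least: "\<And>h. V h \<Longrightarrow> degree g \<le> degree h"
    using arg_min_natI arg_min_nat_le by metis
  have dvd: "g dvd h" if "ac_eval h x = 0" for h
  proof (rule ccontr)
    assume "\<not> g dvd h"
    then have nz: "h mod g \<noteq> 0" by (simp add: mod_eq_0_iff_dvd)
    have "h mod g = h - h div g * g" by (simp add: minus_div_mult_eq_mod)
    then have "V (h mod g)" using nz g that by (simp add: V_def)
    then show False using least degree_mod_less'[of g h] g nz by (auto simp: V_def not_le[symmetric])
  qed
  have "\<not> is_unit g"
  proof
    assume "is_unit g"
    then obtain h where "1 = g * h" by blast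
    then have "ac_eval 1 x = ac_eval g x * ac_eval h x" by (metis ac_eval_mult)
    then show False using g by (simp add: V_def)
  qed
  then have "p dvd g" using p irreducible_altdef[of p] dvd by blast
  then show ?thesis using dvd q dvd_trans by blast
qed

lemma monic_irreducible_dvd_imp_eq:
  fixes p q :: "'a::field poly"
  assumes "irreducible p" "irreducible q" "lead_coeff p = 1" "lead_coeff q = 1" "p dvd q"
  shows "p = q"
proof -
  obtain k where k: "q = p * k" using assms(5) ..
  moreover have "is_unit k"
    using irreducibleD[OF assms(2) k] irreducible_not_unit[OF assms(1)] by blast
  then obtain c where "k = [:c:]" by (auto simp: is_unit_poly_iff)
  ultimately show ?thesis
    using assms(3,4) by (cases "c = 0") auto
qed

text \<open>Vanishing at one root of each irreducible factor of \<open>x\<^sup>n - 1\<close> will give divisibility by each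
  factor; since the factors are pairwise coprime, divisibility by \<open>x\<^sup>n - 1\<close> itself follows.\<close>
lemma prod_list_distinct_irreducibles_dvd:
  fixes ps :: "'a::field poly list"
  assumes "distinct ps"
    and "\<And>p. p \<in> set ps \<Longrightarrow> irreducible p \<and> lead_coeff p = 1 \<and> p dvd q"
  shows "prod_list ps dvd q"
  using assms
proof (induction ps)
  case (Cons p ps)
  then obtain k where k: "q = prod_list ps * k" by (auto elim: dvdE)
  have prime: "prime_elem p"
    using Cons.prems by (auto intro: field_poly_irreducible_imp_prime)
  have "\<not> p dvd prod_list ps"
  proof
    assume "p dvd prod_list ps"
    moreover have "\<exists>p'\<in>set qs. p dvd p'" if "p dvd prod_list qs" for qs
      using that prime by (induction qs) (auto simp: prime_elem_dvd_mult_iff prime_elem_not_unit)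
    ultimately obtain p' where "p' \<in> set ps" "p dvd p'" by blast
    then show False using Cons.prems monic_irreducible_dvd_imp_eq[of p p'] by auto
  qed
  then have "p dvd k" using prime Cons.prems(2)[of p] k by (simp add: prime_elem_dvd_mult_iff)
  then show ?case using k by (simp add: mult.commute mult_dvd_mono)
qed auto

text \<open>Modulo \<open>x\<^sup>n - 1\<close>, the substitution \<open>x \<mapsto> x\<^sup>-\<^sup>1\<close> amounts to permuting coefficients by
  \<open>i \<mapsto> -i mod n\<close>.\<close>
lemma sum_powers_inverse_root_of_unity:
  fixes x :: "'b::field"
  assumes "x ^ n = 1" "n > 0"
  shows "(\<Sum>i<n. g (int i) * inverse x ^ i) = (\<Sum>i<n. g ((- int i) mod int n) * x ^ i)"
proof (rule sum.reindex_bij_witness[of _ "\<lambda>i. nat ((- int i) mod int n)" "\<lambda>i. nat ((- int i) mod int n)"])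
  fix i assume i: "i \<in> {..<n}"
  \<comment> \<open>The permutation is an involution, so the conditions on it and on its inverse coincide.\<close>
  let ?k = "nat ((- int i) mod int n)"
  show "nat (- int ?k mod int n) = i" using i assms by (simp add: mod_simps)
  then show "nat (- int ?k mod int n) = i" .
  show "?k \<in> {..<n}" using assms by (simp add: nat_less_iff)
  then show "?k \<in> {..<n}" .
  have "int n dvd int (?k + i)" using assms by (simp add: mod_simps mod_0_imp_dvd)
  then have "n dvd ?k + i" using int_dvd_int_iff by blast
  then obtain m where "?k + i = n * m" ..
  then have "x ^ ?k * x ^ i = 1" using assms by (metis power_add power_mult power_one)
  then have "inverse x ^ i = x ^ ?k"
    by (metis inverse_unique mult.commute power_inverse)
  then show "g (- int ?k mod int n) * x ^ ?k = g (int i) * inverse x ^ i"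
    using i assms by (simp add: mod_simps)
qed

section \<open>The cyclic and the reflection part of an element\<close>

definition reflection_b :: "bool \<times> int \<Rightarrow> 'a::comm_ring_1"
  where "reflection_b = (\<lambda>g. if g = (True, 0) then 1 else 0)"

lemma carrier_dihedral: "carrier (dihedral n) = UNIV \<times> {0..<int n}"
  by (simp add: dihedral_def)

lemma dihedral_algebra_carrier:
  "u \<in> carrier (dihedral_algebra n) \<longleftrightarrow> (\<forall>e i. i \<notin> {0..<int n} \<longrightarrow> u (e, i) = 0)"
  by (auto simp: dihedral_algebra_def group_algebra_def carrier_dihedral)

lemma dihedral_algebra_add: "u \<oplus>\<^bsub>dihedral_algebra n\<^esub> v = (\<lambda>g. u g + v g)"
  and dihedral_algebra_zero: "\<zero>\<^bsub>dihedral_algebra n\<^esub> = (\<lambda>g. 0)"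
  by (simp_all add: dihedral_algebra_def group_algebra_def)

lemma dihedral_algebra_ring:
  assumes "n > 0"
  shows "ring (dihedral_algebra n :: (bool \<times> int \<Rightarrow> 'a::comm_ring_1) ring)"
  unfolding dihedral_algebra_def
  using assms by (intro group_algebra_ring dihedral_group) (auto simp: carrier_dihedral)

text \<open>The coordinate form of \<open>(P + bQ)(P' + bQ') = (PP' + Q(a\<^sup>-\<^sup>1)Q') + b(P(a\<^sup>-\<^sup>1)Q' + QP')\<close>.\<close>
lemma dihedral_algebra_mult:
  assumes "n > 0" "i \<in> {0..<int n}"
  shows "(u \<otimes>\<^bsub>dihedral_algebra n\<^esub> v) (d, i) =
    (\<Sum>k\<in>{0..<int n}. u (False, k) * v (d, (if d then i + k else i - k) mod int n)) +
    (\<Sum>k\<in>{0..<int n}. u (True, k) * v (\<not> d, (if d then i - k else i + k) mod int n))"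
proof -
  let ?G = "UNIV \<times> {0..<int n} :: (bool \<times> int) set"
  \<comment> \<open>For given left factor \<open>(e, k)\<close> and product \<open>(d, i)\<close> the right factor is \<open>(e \<noteq> d, l e k)\<close>.\<close>
  define l where "l = (\<lambda>e k. (if e \<noteq> d then i + k else i - k) mod int n)"
  have eq: "(e, k) \<otimes>\<^bsub>dihedral n\<^esub> y = (d, i) \<longleftrightarrow> y = (e \<noteq> d, l e k)" if "y \<in> ?G" for e k y
  proof -
    from that obtain e' k' where y: "y = (e', k')" "k' \<in> {0..<int n}" by (cases y) auto
    define s where "s = (if e' then - k else k)"
    have "(s + k') mod int n = i \<longleftrightarrow> k' = (i - s) mod int n"
    proof
      assume "(s + k') mod int n = i"
      then have "(i - s) mod int n = (s + k' - s) mod int n" by (metis mod_diff_left_eq)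
      then show "k' = (i - s) mod int n" using y by simp
    qed (use assms in \<open>simp add: mod_simps\<close>)
    then show ?thesis by (cases e; cases e'; cases d) (auto simp: dihedral_def y s_def l_def)
  qed
  have "(\<Sum>y\<in>?G. if (e, k) \<otimes>\<^bsub>dihedral n\<^esub> y = (d, i) then u (e, k) * v y else 0) =
      u (e, k) * v (e \<noteq> d, l e k)" for e k
  proof -
    have "(\<Sum>y\<in>?G. if (e, k) \<otimes>\<^bsub>dihedral n\<^esub> y = (d, i) then u (e, k) * v y else 0) =
        (\<Sum>y\<in>?G. if y = (e \<noteq> d, l e k) then u (e, k) * v y else 0)"
      by (rule sum.cong) (simp_all only: eq)
    then show ?thesis using assms(1) by (simp add: l_def)
  qed
  then have "(u \<otimes>\<^bsub>dihedral_algebra n\<^esub> v) (d, i) =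
      (\<Sum>(e, k)\<in>?G. u (e, k) * v (e \<noteq> d, l e k))"
    by (auto simp: dihedral_algebra_def group_algebra_def carrier_dihedral intro!: sum.cong)
  also have "\<dots> = (\<Sum>e\<in>UNIV. \<Sum>k\<in>{0..<int n}. u (e, k) * v (e \<noteq> d, l e k))"
    by (rule sum.cartesian_product[symmetric])
  finally show ?thesis by (cases d) (simp_all add: UNIV_bool l_def add.commute)
qed

lemma dihedral_algebra_mult_outside:
  assumes "i \<notin> {0..<int n}"
  shows "(u \<otimes>\<^bsub>dihedral_algebra n\<^esub> v) (d, i) = 0"
proof (cases "n > 0")
  case True
  then have "(x \<otimes>\<^bsub>dihedral n\<^esub> y) \<noteq> (d, i)" for x y
    using assms by (cases x; cases y) (auto simp: dihedral_def)
  then show ?thesis by (simp add: dihedral_algebra_def group_algebra_def)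
qed (simp add: dihedral_algebra_def group_algebra_def carrier_dihedral)

lemma reflection_b_carrier: "n > 0 \<Longrightarrow> reflection_b \<in> carrier (dihedral_algebra n)"
  by (auto simp: dihedral_algebra_carrier reflection_b_def)

lemma reflection_b_mult:
  assumes "n > 0" "v \<in> carrier (dihedral_algebra n)"
  shows "(reflection_b \<otimes>\<^bsub>dihedral_algebra n\<^esub> v) (e, i) = v (\<not> e, i)"
proof (cases "i \<in> {0..<int n}")
  case True
  have "reflection_b (True, k) * v (\<not> e, (if e then i - k else i + k) mod int n) =
      (if k = 0 then v (\<not> e, i) else 0)" for k
    using True by (simp add: reflection_b_def)
  then show ?thesis
    unfolding dihedral_algebra_mult[OF assms(1) True] using assms(1) by (simp add: reflection_b_def)
next
  case False
  then have "v (\<not> e, i) = 0"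
    using assms(2) by (simp add: dihedral_algebra_carrier del: atLeastLessThan_iff)
  then show ?thesis using dihedral_algebra_mult_outside[OF False] by simp
qed

text \<open>From \<open>bQ(a)b = Q(a\<^sup>-\<^sup>1)\<close>.\<close>
lemma mult_reflection_b:
  assumes "n > 0" "i \<in> {0..<int n}"
  shows "(v \<otimes>\<^bsub>dihedral_algebra n\<^esub> reflection_b) (False, i) = v (True, (- i) mod int n)"
proof -
  have "v (True, k) * reflection_b (True, (i + k) mod int n) =
      (if k = (- i) mod int n then v (True, k) else 0)" if "k \<in> {0..<int n}" for k
  proof -
    have "(i + k) mod int n = 0 \<longleftrightarrow> k = (- i) mod int n"
    proof
      assume "(i + k) mod int n = 0"
      then have "(i + k - i) mod int n = (- i) mod int n"
        by (metis diff_conv_add_uminus mod_add_left_eq add_0)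
      then show "k = (- i) mod int n" using that by simp
    qed (simp add: mod_simps)
    then show ?thesis by (simp add: reflection_b_def)
  qed
  then show ?thesis
    unfolding dihedral_algebra_mult[OF assms] using assms
    by (simp add: reflection_b_def)
qed

lemma sum_mod_uminus:
  assumes "n > 0"
  shows "(\<Sum>k\<in>{0..<int n}. g ((- k) mod int n)) = (\<Sum>k\<in>{0..<int n}. g k)"
  by (rule sum.reindex_bij_witness[of _ "\<lambda>k. (- k) mod int n" "\<lambda>k. (- k) mod int n"])
    (use assms in \<open>auto simp: mod_simps\<close>)

lemma pr_a_simps [simp]: "pr_a u (False, i) = u (False, i)" "pr_a u (True, i) = 0"
  by (simp_all add: pr_a_def)

lemma pr_a_pr_a [simp]: "pr_a (pr_a u) = pr_a u"
  by (auto simp: pr_a_def)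

lemma pr_a_carrier: "u \<in> carrier (dihedral_algebra n) \<Longrightarrow> pr_a u \<in> carrier (dihedral_algebra n)"
  by (auto simp: dihedral_algebra_carrier pr_a_def)

text \<open>Since \<open>b\<^sup>2 = 1\<close>, one has \<open>xv = (xb)(bv)\<close>. A product of two group elements is a rotation exactly
  when both are rotations or both are reflections; the first case contributes to \<open>xv\<close> the product of
  the cyclic parts of \<open>x\<close> and \<open>v\<close>, the second that of the cyclic parts of \<open>xb\<close> and \<open>bv\<close>.\<close>
lemma pr_a_mult:
  fixes x v :: "bool \<times> int \<Rightarrow> 'a::comm_ring_1"
  assumes "n > 0" "v \<in> carrier (dihedral_algebra n)"
  defines "R \<equiv> dihedral_algebra n :: (bool \<times> int \<Rightarrow> 'a) ring"
  shows "pr_a (x \<otimes>\<^bsub>R\<^esub> v) =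
    pr_a x \<otimes>\<^bsub>R\<^esub> pr_a v \<oplus>\<^bsub>R\<^esub> pr_a (x \<otimes>\<^bsub>R\<^esub> reflection_b) \<otimes>\<^bsub>R\<^esub> pr_a (reflection_b \<otimes>\<^bsub>R\<^esub> v)"
proof
  fix g :: "bool \<times> int"
  obtain d i where g: "g = (d, i)" by (cases g)
  let ?n = "int n"
  show "pr_a (x \<otimes>\<^bsub>R\<^esub> v) g =
    (pr_a x \<otimes>\<^bsub>R\<^esub> pr_a v \<oplus>\<^bsub>R\<^esub> pr_a (x \<otimes>\<^bsub>R\<^esub> reflection_b) \<otimes>\<^bsub>R\<^esub> pr_a (reflection_b \<otimes>\<^bsub>R\<^esub> v)) g"
  proof (cases "i \<in> {0..<?n}")
    case True
    show ?thesis
    proof (cases d)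
      case d: False
      have "(\<Sum>k\<in>{0..<?n}. (x \<otimes>\<^bsub>R\<^esub> reflection_b) (False, k) * v (True, (i - k) mod ?n)) =
          (\<Sum>k\<in>{0..<?n}. x (True, (- k) mod ?n) * v (True, (i + (- k) mod ?n) mod ?n))"
        unfolding R_def using assms(1) by (intro sum.cong) (auto simp: mult_reflection_b mod_simps)
      also have "\<dots> = (\<Sum>k\<in>{0..<?n}. x (True, k) * v (True, (i + k) mod ?n))"
        by (rule sum_mod_uminus[OF assms(1), of "\<lambda>k. x (True, k) * v (True, (i + k) mod ?n)"])
      finally have reindex: "(\<Sum>k\<in>{0..<?n}. (x \<otimes>\<^bsub>R\<^esub> reflection_b) (False, k) * v (True, (i - k) mod ?n)) =
          (\<Sum>k\<in>{0..<?n}. x (True, k) * v (True, (i + k) mod ?n))" .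
      have "(pr_a y \<otimes>\<^bsub>R\<^esub> pr_a w) (False, i) =
          (\<Sum>k\<in>{0..<?n}. y (False, k) * w (False, (i - k) mod ?n))" for y w :: "bool \<times> int \<Rightarrow> 'a"
        using True assms(1) by (simp add: R_def dihedral_algebra_mult)
      then show ?thesis
        using d reindex dihedral_algebra_mult[OF assms(1) True, of x v False]
        by (simp add: g R_def dihedral_algebra_add reflection_b_mult[OF assms(1,2)])
    qed (use True assms(1) in \<open>simp add: g R_def dihedral_algebra_add dihedral_algebra_mult\<close>)
  qed (cases d; simp add: g R_def dihedral_algebra_add dihedral_algebra_mult_outside)
qed

section \<open>The exterior induced code\<close>

text \<open>The projection \<open>pr\<^sub>a\<close> commutes with left multiplication by elements of the cyclic group algebra, so
  it maps left ideals of the dihedral group algebra to ideals of the cyclic one.\<close>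
lemma pr_a_left_mult:
  fixes C :: "(bool \<times> int \<Rightarrow> 'a::comm_ring_1) set" and x c
  assumes n: "n > 0" and C: "left_ideal C (dihedral_algebra n)"
    and x: "x \<in> carrier (dihedral_algebra n)" and c: "c \<in> pr_a ` C"
  shows "pr_a x \<otimes>\<^bsub>dihedral_algebra n\<^esub> c \<in> pr_a ` C"
proof -
  let ?R = "dihedral_algebra n :: (bool \<times> int \<Rightarrow> 'a) ring"
  interpret ring ?R by (rule dihedral_algebra_ring[OF n])
  obtain c' where c': "c' \<in> C" "c = pr_a c'" using c by blast
  have "C \<subseteq> carrier ?R" using C by (auto simp: left_ideal_def dest: additive_subgroup.a_Hcarr)
  then have c'R: "c' \<in> carrier ?R" using c' by blast
  have "pr_a (pr_a x \<otimes>\<^bsub>?R\<^esub> reflection_b) = \<zero>\<^bsub>?R\<^esub>"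
  proof
    fix g :: "bool \<times> int"
    obtain d i where "g = (d, i)" by (cases g)
    then show "pr_a (pr_a x \<otimes>\<^bsub>?R\<^esub> reflection_b) g = \<zero>\<^bsub>?R\<^esub> g"
      by (cases d; cases "i \<in> {0..<int n}")
        (simp_all add: dihedral_algebra_zero mult_reflection_b n dihedral_algebra_mult_outside del: atLeastLessThan_iff)
  qed
  then have "pr_a (pr_a x \<otimes>\<^bsub>?R\<^esub> c') = pr_a x \<otimes>\<^bsub>?R\<^esub> c"
    using pr_a_mult[OF n c'R, of "pr_a x"] c'(2) c'R x n
    by (simp add: pr_a_carrier reflection_b_carrier)
  moreover have "pr_a x \<otimes>\<^bsub>?R\<^esub> c' \<in> C"
    using C c' x by (simp add: left_ideal_def pr_a_carrier)
  ultimately show ?thesis by (metis imageI)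
qed

text \<open>Writing \<open>J = pr\<^sub>a(C)\<close>, the set \<open>J + bJ\<close> of all \<open>v\<close> whose two parts \<open>pr\<^sub>a(v)\<close> and \<open>pr\<^sub>a(bv)\<close> lie in
  \<open>J\<close> is a left ideal containing \<open>J\<close>, hence contains the exterior code. It is closed under left
  multiplication because the cyclic part of \<open>xv\<close> is a combination of those two parts with
  coefficients in the cyclic group algebra, and the cyclic part of \<open>b(xv) = (bx)v\<close> is covered by the
  same observation for \<open>bx\<close>.\<close>
lemma exterior_code_components:
  fixes C :: "(bool \<times> int \<Rightarrow> 'a::comm_ring_1) set"
  assumes n: "n > 0" and C: "left_ideal C (dihedral_algebra n)" and v: "v \<in> exterior_code n C"
  shows "v \<in> carrier (dihedral_algebra n)" and "pr_a v \<in> pr_a ` C"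
    and "pr_a (reflection_b \<otimes>\<^bsub>dihedral_algebra n\<^esub> v) \<in> pr_a ` C"
proof -
  let ?R = "dihedral_algebra n :: (bool \<times> int \<Rightarrow> 'a) ring"
  let ?b = "reflection_b :: bool \<times> int \<Rightarrow> 'a"
  interpret ring ?R by (rule dihedral_algebra_ring[OF n])
  interpret C: additive_subgroup C ?R using C by (simp add: left_ideal_def)
  have b: "?b \<in> carrier ?R" by (rule reflection_b_carrier[OF n])
  have pr_add: "pr_a (u \<oplus>\<^bsub>?R\<^esub> w) = pr_a u \<oplus>\<^bsub>?R\<^esub> pr_a w" for u w :: "bool \<times> int \<Rightarrow> 'a"
    by (auto simp: dihedral_algebra_add pr_a_def)
  have J_add: "u \<oplus>\<^bsub>?R\<^esub> w \<in> pr_a ` C" if "u \<in> pr_a ` C" "w \<in> pr_a ` C" for u w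
    using that C.a_closed by (auto simp: pr_add[symmetric])
  have J_zero: "\<zero>\<^bsub>?R\<^esub> \<in> pr_a ` C"
  proof -
    have "pr_a \<zero>\<^bsub>?R\<^esub> = \<zero>\<^bsub>?R\<^esub>" by (auto simp: dihedral_algebra_zero pr_a_def)
    then show ?thesis using C.zero_closed by (metis imageI)
  qed
  define L where "L = {v \<in> carrier ?R. pr_a v \<in> pr_a ` C \<and> pr_a (?b \<otimes>\<^bsub>?R\<^esub> v) \<in> pr_a ` C}"
  have pr_mult: "pr_a (x \<otimes>\<^bsub>?R\<^esub> v) \<in> pr_a ` C" if "x \<in> carrier ?R" "v \<in> L" for x v
    using that b pr_a_mult[OF n, of v x]
    by (auto simp: L_def intro!: J_add pr_a_left_mult[OF n C])
  have L_mult: "x \<otimes>\<^bsub>?R\<^esub> v \<in> L" if "x \<in> carrier ?R" "v \<in> L" for x v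
    using that b pr_mult[of x v] pr_mult[of "?b \<otimes>\<^bsub>?R\<^esub> x" v] by (simp add: L_def m_assoc)
  have "left_ideal L ?R"
    unfolding left_ideal_def
  proof (intro conjI ballI additive_subgroup.intro add.subgroupI)
    show "L \<subseteq> carrier ?R" by (auto simp: L_def)
    have "pr_a \<zero>\<^bsub>?R\<^esub> = \<zero>\<^bsub>?R\<^esub>" by (auto simp: dihedral_algebra_zero pr_a_def)
    then have "\<zero>\<^bsub>?R\<^esub> \<in> L" using J_zero b by (simp add: L_def)
    then show "L \<noteq> {}" by blast
    show "\<ominus>\<^bsub>?R\<^esub> v \<in> L" if "v \<in> L" for v
      using L_mult[of "\<ominus>\<^bsub>?R\<^esub> \<one>\<^bsub>?R\<^esub>" v] that by (simp add: L_def l_minus)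
    show "u \<oplus>\<^bsub>?R\<^esub> w \<in> L" if "u \<in> L" "w \<in> L" for u w
      using that b by (auto simp: L_def r_distr pr_add intro!: J_add)
  qed (rule L_mult)
  moreover have "pr_a ` C \<subseteq> L"
  proof
    fix c assume "c \<in> pr_a ` C"
    then obtain c' where c: "c = pr_a c'" "c' \<in> C" by blast
    have "c \<in> carrier ?R" using c C.a_Hcarr by (simp add: pr_a_carrier)
    moreover from this have "pr_a (?b \<otimes>\<^bsub>?R\<^esub> c) = \<zero>\<^bsub>?R\<^esub>"
      using n c(1) by (auto simp: pr_a_def reflection_b_mult dihedral_algebra_zero)
    ultimately show "c \<in> L" using c J_zero by (simp add: L_def)
  qed
  ultimately have "v \<in> L"
    using v by (auto simp: exterior_code_def left_ideal_gen_def)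
  then show "v \<in> carrier ?R" "pr_a v \<in> pr_a ` C" "pr_a (?b \<otimes>\<^bsub>?R\<^esub> v) \<in> pr_a ` C"
    by (auto simp: L_def)
qed

section \<open>Weights and minimum distances\<close>

lemma dihedral_support_subset:
  assumes "u \<in> carrier (dihedral_algebra n)"
  shows "{g. u g \<noteq> 0} \<subseteq> UNIV \<times> {0..<int n}"
  using assms by (auto simp: dihedral_algebra_carrier) (metis not_le)+

lemma dihedral_support_finite:
  assumes "u \<in> carrier (dihedral_algebra n)"
  shows "finite {g. u g \<noteq> 0}"
  using dihedral_support_subset[OF assms] by (rule finite_subset) simp

lemma hamming_weight_pr_a_le:
  assumes "u \<in> carrier (dihedral_algebra n)"
  shows "hamming_weight (pr_a u) \<le> hamming_weight u"
  unfolding hamming_weight_def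
  by (rule card_mono[OF dihedral_support_finite[OF assms]]) (auto simp: pr_a_def split: if_splits)

lemma hamming_weight_reflection_b_mult:
  assumes "n > 0" "u \<in> carrier (dihedral_algebra n)"
  shows "hamming_weight (reflection_b \<otimes>\<^bsub>dihedral_algebra n\<^esub> u) = hamming_weight u"
  unfolding hamming_weight_def
  by (rule bij_betw_same_card[of "\<lambda>(e, i). (\<not> e, i)"])
    (auto simp: reflection_b_mult[OF assms] intro!: bij_betwI[of _ _ _ "\<lambda>(e, i). (\<not> e, i)"])

text \<open>An element \<open>P(a) + bP(a\<^sup>-\<^sup>1)\<close> carries each coefficient of \<open>P\<close> twice: once on a rotation and once
  on a reflection.\<close>
lemma hamming_weight_symmetric:
  assumes n: "n > 0" and u: "u \<in> carrier (dihedral_algebra n)"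
    and sym: "\<And>i. i \<in> {0..<int n} \<Longrightarrow> u (True, i) = u (False, (- i) mod int n)"
  shows "hamming_weight u = 2 * hamming_weight (pr_a u)"
proof -
  let ?S = "\<lambda>d. {g. fst g = d \<and> u g \<noteq> 0}"
  have sub: "i \<in> {0..<int n}" if "u (d, i) \<noteq> 0" for d i
    using that dihedral_support_subset[OF u] by auto
  have fin: "finite (?S d)" for d
    by (rule finite_subset[OF _ dihedral_support_finite[OF u]]) auto
  have "bij_betw (\<lambda>(e, i). (\<not> e, (- i) mod int n)) (?S True) (?S False)"
    by (rule bij_betwI[of _ _ _ "\<lambda>(e, i). (\<not> e, (- i) mod int n)"])
      (use sub sym n in \<open>force simp: mod_simps\<close>)+
  then have "card (?S True) = card (?S False)" by (rule bij_betw_same_card)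
  moreover have "card (?S True \<union> ?S False) = card (?S True) + card (?S False)"
    by (rule card_Un_disjoint[OF fin fin]) auto
  moreover have "hamming_weight u = card (?S True \<union> ?S False)"
    unfolding hamming_weight_def by (rule arg_cong[of _ _ card]) auto
  moreover have "pr_a u g \<noteq> 0 \<longleftrightarrow> fst g = False \<and> u g \<noteq> 0" for g
    by (cases g; cases "fst g") simp_all
  then have "hamming_weight (pr_a u) = card (?S False)"
    unfolding hamming_weight_def by (simp only:)
  ultimately show ?thesis by linarith
qed

text \<open>For a code consisting of elements \<open>P(a) + bP(a\<^sup>-\<^sup>1) = P(a)(1 + b)\<close>, both minimum distances are
  computed from that of \<open>J = pr\<^sub>a(C)\<close>. For \<open>C\<close> every weight is twice the weight in \<open>J\<close>. The exterior
  code contains \<open>J\<close>, and a nonzero element of it has its two parts in \<open>J\<close>, at least one of them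
  nonzero, so its weight is at least the minimum distance of \<open>J\<close>. The code has to be nonzero because
  the minimum over an empty set of weights is an unspecified number.\<close>
lemma min_distance_symmetric_code:
  fixes C :: "(bool \<times> int \<Rightarrow> 'a::comm_ring_1) set"
  assumes n: "n > 0" and C: "left_ideal C (dihedral_algebra n)"
    and sym: "\<And>u i. u \<in> C \<Longrightarrow> i \<in> {0..<int n} \<Longrightarrow> u (True, i) = u (False, (- i) mod int n)"
    and nontrivial: "\<exists>c\<in>C. c \<noteq> (\<lambda>g. 0)"
  shows "min_distance C = 2 * min_distance (exterior_code n C)"
proof -
  let ?R = "dihedral_algebra n :: (bool \<times> int \<Rightarrow> 'a) ring"
  let ?nz = "\<lambda>D :: (bool \<times> int \<Rightarrow> 'a) set. {c \<in> D. c \<noteq> (\<lambda>g. 0)}"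
  let ?b = "reflection_b :: bool \<times> int \<Rightarrow> 'a"
  have CR: "C \<subseteq> carrier ?R" using C by (auto simp: left_ideal_def dest: additive_subgroup.a_Hcarr)
  have wt: "hamming_weight u = 2 * hamming_weight (pr_a u)" if "u \<in> C" for u
    using hamming_weight_symmetric[OF n] that CR sym by blast
  have pr_nz: "pr_a u \<noteq> (\<lambda>g. 0)" if "u \<in> C" "u \<noteq> (\<lambda>g. 0)" for u
  proof -
    from that(2) obtain g where "u g \<noteq> 0" by (meson ext)
    then have "{g. u g \<noteq> 0} \<noteq> {}" by blast
    then have "hamming_weight u > 0"
      using dihedral_support_finite[of u n] that CR by (auto simp: hamming_weight_def card_gt_0_iff)
    then show ?thesis using wt[OF that(1)] by (auto simp: hamming_weight_def)
  qed
  have fin: "finite (hamming_weight ` ?nz D)" if "D \<subseteq> carrier ?R" for D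
  proof (rule finite_subset)
    have "hamming_weight c \<le> card ((UNIV :: bool set) \<times> {0..<int n})" if "c \<in> D" for c
      unfolding hamming_weight_def
      using that \<open>D \<subseteq> carrier ?R\<close> by (intro card_mono dihedral_support_subset) auto
    then show "hamming_weight ` ?nz D \<subseteq> {..card ((UNIV :: bool set) \<times> {0..<int n})}" by blast
  qed simp
  let ?d = "min_distance (pr_a ` C)"
  have J: "pr_a ` C \<subseteq> carrier ?R" using CR pr_a_carrier by blast
  have ne: "hamming_weight ` ?nz (pr_a ` C) \<noteq> {}" using nontrivial pr_nz by auto
  have d: "?d \<in> hamming_weight ` ?nz (pr_a ` C)"
    unfolding min_distance_def by (rule Min_in[OF fin[OF J] ne])
  have d_le: "?d \<le> hamming_weight c" if "c \<in> pr_a ` C" "c \<noteq> (\<lambda>g. 0)" for c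
    unfolding min_distance_def using that by (intro Min_le fin[OF J]) auto
  have "min_distance C = 2 * ?d"
    unfolding min_distance_def[of C]
  proof (rule Min_eqI[OF fin[OF CR]])
    show "2 * ?d \<le> w" if "w \<in> hamming_weight ` ?nz C" for w
      using that wt d_le pr_nz by auto
    from d obtain c where "c \<in> C" "pr_a c \<noteq> (\<lambda>g. 0)" "?d = hamming_weight (pr_a c)" by auto
    then show "2 * ?d \<in> hamming_weight ` ?nz C"
      using wt by (intro image_eqI[of _ _ c]) (auto simp: pr_a_def)
  qed
  moreover have "min_distance (exterior_code n C) = ?d"
    unfolding min_distance_def[of "exterior_code n C"]
  proof (rule Min_eqI)
    show "finite (hamming_weight ` ?nz (exterior_code n C))"
      using exterior_code_components(1)[OF n C] by (intro fin) blast
    have "pr_a ` C \<subseteq> exterior_code n C" by (auto simp: exterior_code_def left_ideal_gen_def)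
    then show "?d \<in> hamming_weight ` ?nz (exterior_code n C)" using d by blast
    fix w assume "w \<in> hamming_weight ` ?nz (exterior_code n C)"
    then obtain v where v: "v \<in> exterior_code n C" "v \<noteq> (\<lambda>g. 0)" "w = hamming_weight v" by blast
    let ?bv = "?b \<otimes>\<^bsub>?R\<^esub> v"
    note vC = exterior_code_components[OF n C v(1)]
    have bv: "?bv \<in> carrier ?R"
      using vC(1) by (auto simp: dihedral_algebra_carrier reflection_b_mult[OF n vC(1)])
    show "?d \<le> w"
    proof (cases "pr_a v = (\<lambda>g. 0)")
      case False
      then show ?thesis
        using d_le[OF vC(2)] hamming_weight_pr_a_le[OF vC(1)] v(3) by simp
    next
      case True
      obtain e i where ei: "v (e, i) \<noteq> 0" using v(2) by force
      then have "e" using fun_cong[OF True, of "(e, i)"] by (cases e) auto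
      then have "pr_a ?bv (False, i) \<noteq> 0" using ei by (simp add: reflection_b_mult[OF n vC(1)])
      then have "pr_a ?bv \<noteq> (\<lambda>g. 0)" by metis
      then show ?thesis
        using d_le[OF vC(3)] hamming_weight_pr_a_le[OF bv] hamming_weight_reflection_b_mult[OF n vC(1)] v(3)
        by simp
    qed
  qed
  ultimately show ?thesis by simp
qed

section \<open>The ideals prescribed in the decomposition\<close>

lemma mat2_entries [simp]:
  "mat2 a b c d $ 1 $ 1 = a" "mat2 a b c d $ 1 $ 2 = b"
  "mat2 a b c d $ 2 $ 1 = c" "mat2 a b c d $ 2 $ 2 = d"
  by (simp_all add: mat2_def)

lemma mat2_eq_iff: "mat2 a b c d = mat2 a' b' c' d' \<longleftrightarrow> a = a' \<and> b = b' \<and> c = c' \<and> d = d'"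
  by (auto simp: vec_eq_iff forall_2)

lemma mat2_mult:
  fixes a b c d :: "'b::field"
  shows "mat2 a b c d ** mat2 a' b' c' d' =
    mat2 (a * a' + b * c') (a * b' + b * d') (c * a' + d * c') (c * b' + d * d')"
  by (simp add: vec_eq_iff forall_2 matrix_matrix_mult_def sum_2)

lemma mat2_id: "mat 1 = mat2 1 0 0 (1::'b::field)"
  by (simp add: vec_eq_iff forall_2 mat_def)

text \<open>The rows of a matrix in \<open>I\<^sub>j(x + x\<^sup>-\<^sup>1, 2)\<close> are multiples of \<open>(2, -(x + x\<^sup>-\<^sup>1)) = (1, 1)Z\<close>, so
  conjugating back by \<open>Z\<close> gives a matrix whose rows are multiples of \<open>(1, 1)\<close>.\<close>
lemma sigma_mem_I_mat_imp_equal_columns: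
  fixes x :: "'b::field"
  assumes x: "x \<noteq> 0" "x \<noteq> inverse x"
    and mem: "sigma x (mat2 a b c d) \<in> I_mat F (x + inverse x) 2"
  shows "a = b \<and> c = d"
proof -
  define y where "y = inverse x"
  define Z where "Z = mat2 1 (- x) 1 (- y)"
  let ?M = "mat2 a b c d"
  define e where "e = inverse (x - y)"
  \<comment> \<open>\<open>e\<close> is the inverse of the determinant of \<open>Z\<close>, from which \<open>Z\<^sup>-\<^sup>1\<close> is written down explicitly.\<close>
  have e: "x * e - y * e = 1" using x by (simp add: e_def y_def left_diff_distrib[symmetric])
  have "Z ** mat2 (- y * e) (x * e) (- e) e = mat 1" "mat2 (- y * e) (x * e) (- e) e ** Z = mat 1"
    unfolding Z_def mat2_mult mat2_id mat2_eq_iff using e by (simp_all add: ac_simps)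
  then have "\<exists>Z'. Z ** Z' = mat 1 \<and> Z' ** Z = mat 1" by blast
  then have inv: "Z ** matrix_inv Z = mat 1" unfolding matrix_inv_def by (rule someI2_ex) blast
  obtain k t where "sigma x ?M = mat2 (k * 2) (- (k * (x + y))) (t * 2) (- (t * (x + y)))"
    using mem by (auto simp: I_mat_def y_def)
  then have "Z ** (matrix_inv Z ** ?M ** Z) = Z ** mat2 (k * 2) (- (k * (x + y))) (t * 2) (- (t * (x + y)))"
    by (simp add: sigma_def Z_def y_def Let_def)
  then have "?M ** Z = Z ** mat2 (k * 2) (- (k * (x + y))) (t * 2) (- (t * (x + y)))"
    by (simp add: matrix_mul_assoc inv)
  note entries = this[unfolded Z_def mat2_mult mat2_eq_iff]
  have "a + b = (k - x * t) * 2"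
    using entries[THEN conjunct1] by (simp add: algebra_simps)
  moreover have "a * x + b * y = (k - x * t) * (x + y)"
    using entries[THEN conjunct2, THEN conjunct1] by (simp add: algebra_simps)
  moreover have "c + d = (k - y * t) * 2"
    using entries[THEN conjunct2, THEN conjunct2, THEN conjunct1] by (simp add: algebra_simps)
  moreover have "c * x + d * y = (k - y * t) * (x + y)"
    using entries[THEN conjunct2, THEN conjunct2, THEN conjunct2] by (simp add: algebra_simps)
  moreover have "p = q" if "p + q = w * 2" "p * x + q * y = w * (x + y)" for p q w
  proof -
    \<comment> \<open>Two linear equations for \<open>(p, q)\<close> with determinant \<open>y - x \<noteq> 0\<close>; one solution is \<open>(w, w)\<close>.\<close>
    have q: "q = w * 2 - p" using that(1) by (simp add: eq_diff_eq add.commute)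
    have "(p - w) * (x - y) = 0" using that(2) unfolding q by (simp add: algebra_simps)
    then have "p = w" using x by (simp add: y_def)
    then show ?thesis using that(1) by (simp add: mult_2_right)
  qed
  ultimately show ?thesis by blast
qed

lemma C2_mult_sum_elem:
  "(z \<otimes>\<^bsub>C2_algebra\<^esub> C2_elem 1 1) g = (if g = 0 \<or> g = 1 then z 0 + z 1 else 0)"
proof -
  have "{0..<2::int} = {0, 1}" by auto
  then show ?thesis
    by (auto simp: C2_algebra_def group_algebra_def C2_elem_def carrier_integer_mod_group)
qed

lemma C2_elem_mem_I_C2_imp_eq: "C2_elem c d \<in> I_C2 1 0 \<Longrightarrow> c = d"
  by (auto simp: I_C2_def fun_eq_iff C2_mult_sum_elem)
    (metis (mono_tags, lifting) C2_elem_def zero_neq_one)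

text \<open>The next facts serve to show that the code is nonzero: each ideal prescribed for an index in \<open>K\<close>
  has two different elements.\<close>
lemma I_C2_nontrivial: "\<exists>v\<in>I_C2 1 0. \<exists>w\<in>I_C2 1 0. v \<noteq> (w :: int \<Rightarrow> 'a::comm_ring_1)"
proof -
  have mem: "z \<otimes>\<^bsub>C2_algebra\<^esub> C2_elem 1 1 \<in> I_C2 1 (0::'a)" if "z \<in> carrier C2_algebra" for z
    using that by (auto simp: I_C2_def)
  have "C2_elem c 0 \<in> carrier C2_algebra" for c :: 'a
    by (auto simp: C2_algebra_def group_algebra_def C2_elem_def carrier_integer_mod_group)
  note this[THEN mem]
  moreover have "(C2_elem 0 0 \<otimes>\<^bsub>C2_algebra\<^esub> C2_elem 1 1) \<noteq> C2_elem (1::'a) 0 \<otimes>\<^bsub>C2_algebra\<^esub> C2_elem 1 1"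
  proof -
    have "(C2_elem c 0 \<otimes>\<^bsub>C2_algebra\<^esub> C2_elem 1 1) 0 = c" for c :: 'a
      unfolding C2_mult_sum_elem by (simp add: C2_elem_def)
    then show ?thesis by (metis zero_neq_one)
  qed
  ultimately show ?thesis by metis
qed

lemma I_mat_nontrivial:
  assumes "0 \<in> F" "1 \<in> F" "x \<noteq> 0 \<or> y \<noteq> 0"
  shows "\<exists>v\<in>I_mat F x y. \<exists>w\<in>I_mat F x y. v \<noteq> w"
proof -
  have mem: "mat2 (k * y) (- (k * x)) 0 0 \<in> I_mat F x y" if "k \<in> F" for k
    using that assms(1) by (force simp: I_mat_def)
  moreover have "mat2 (0 * y) (- (0 * x)) 0 0 \<noteq> mat2 (1 * y) (- (1 * x)) 0 0"
    using assms(3) by (auto simp: mat2_eq_iff)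
  ultimately show ?thesis using assms(1,2) by blast
qed

lemma zero_one_mem_F_field:
  fixes \<alpha> :: "nat \<Rightarrow> 'a::field alg_closure"
  shows "0 \<in> F_field r \<alpha> j" "1 \<in> F_field r \<alpha> j"
proof -
  have "ac_eval p x \<in> adjoin x" for p and x :: "'a alg_closure" by (simp add: adjoin_def)
  from this[of 0] this[of 1] have "0 \<in> adjoin x" "1 \<in> adjoin x" for x :: "'a alg_closure"
    by simp_all
  then show "0 \<in> F_field r \<alpha> j" "1 \<in> F_field r \<alpha> j" by (simp_all add: F_field_def)
qed

lemma ex_neq_if_image_eq_PiE:
  assumes "h ` C = Pi\<^sub>E I S" "\<And>i. i \<in> I \<Longrightarrow> S i \<noteq> {}"
    and "j \<in> I" "v \<in> S j" "w \<in> S j" "v \<noteq> w"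
  shows "\<exists>c\<in>C. c \<noteq> z"
proof (rule ccontr)
  assume neg: "\<not> (\<exists>c\<in>C. c \<noteq> z)"
  obtain g where g: "g \<in> Pi\<^sub>E I S" using assms(2) by (metis PiE_eq_empty_iff ex_in_conv)
  have "g(j := y) = h z" if "y \<in> S j" for y
  proof -
    have "g(j := y) \<in> h ` C" using that g assms(1,3) by (auto simp: PiE_iff extensional_def)
    then obtain c where "c \<in> C" "g(j := y) = h c" by (auto simp only: image_iff)
    then show ?thesis using neg by simp
  qed
  note this[OF assms(4)] this[OF assms(5)]
  then have "(g(j := v)) j = (g(j := w)) j" by simp
  then show False using assms by simp
qed

section \<open>Reading off the code from its decomposition\<close>

lemma ac_eval_P_poly: "ac_eval (P_poly n u) x = (\<Sum>i<n. to_ac (u (False, int i)) * x ^ i)"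
  by (simp add: P_poly_def)

text \<open>Let \<open>P'\<close> be the polynomial of degree less than \<open>n\<close> with \<open>P'(a) = P(a\<^sup>-\<^sup>1)\<close>. By hypothesis \<open>Q - P'\<close>
  vanishes at \<open>\<alpha>\<^sub>j\<close> and \<open>\<alpha>\<^sub>j\<^sup>-\<^sup>1\<close> for every \<open>j\<close>, so all the distinct irreducible factors \<open>f\<^sub>j\<close> and \<open>f\<^sub>j\<^sup>*\<close>
  of \<open>x\<^sup>n - 1\<close> divide it. Its degree is less than \<open>n\<close>, so it is zero.\<close>
lemma coeffs_symmetric_if_factor_roots:
  fixes f :: "nat \<Rightarrow> 'a::field poly"
  assumes n: "n > 0" and fact: "xn1_factorization n f r s"
    and \<alpha>: "\<forall>j\<in>{1..r+s}. ac_eval (f j) (\<alpha> j) = 0"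
    and root: "\<And>j. j \<in> {1..r+s} \<Longrightarrow>
      ac_eval (Q_poly n u) (\<alpha> j) = ac_eval (P_poly n u) (inverse (\<alpha> j)) \<and>
      ac_eval (Q_poly n u) (inverse (\<alpha> j)) = ac_eval (P_poly n u) (\<alpha> j)"
    and \<alpha>n: "\<And>j. j \<in> {1..r+s} \<Longrightarrow> \<alpha> j ^ n = 1"
    and i: "i \<in> {0..<int n}"
  shows "u (True, i) = u (False, (- i) mod int n)"
proof -
  define P' where "P' = P_poly n (\<lambda>(e, i). u (e, (- i) mod int n))"
  define R where "R = Q_poly n u - P'"
  let ?f' = "\<lambda>j. make_monic (reflect_poly (f j))"
  let ?ps = "map f [1..<r+s+1] @ map ?f' [r+1..<r+s+1]"
  have P': "ac_eval P' x = ac_eval (P_poly n u) (inverse x)" if "x ^ n = 1" for x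
    using sum_powers_inverse_root_of_unity[OF that n, of "\<lambda>i. to_ac (u (False, i))"]
    by (simp add: P'_def ac_eval_P_poly)
  have R: "ac_eval R (\<alpha> j) = 0" "ac_eval R (inverse (\<alpha> j)) = 0" if "j \<in> {1..r+s}" for j
    using root[OF that] \<alpha>n[OF that] by (auto simp: R_def P' power_inverse)
  have nz: "\<alpha> j \<noteq> 0" if "j \<in> {1..r+s}" for j
    using \<alpha>n[OF that] n by (metis power_0_left zero_neq_one not_gr_zero)
  have "prod_list ?ps dvd R"
  proof (rule prod_list_distinct_irreducibles_dvd)
    show "distinct ?ps" using fact by (simp add: xn1_factorization_def)
    fix p assume p: "p \<in> set ?ps"
    have "set ?ps = f ` {1..r+s} \<union> ?f' ` {r+1..r+s}"
      by (simp add: atLeastLessThanSuc_atLeastAtMost del: upt_Suc)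
    with p consider j where "j \<in> {1..r+s}" "p = f j" | j where "j \<in> {r+1..r+s}" "p = ?f' j"
      by blast
    then show "irreducible p \<and> lead_coeff p = 1 \<and> p dvd R"
    proof cases
      case (1 j)
      then have "irreducible p" "lead_coeff p = 1"
        using fact by (auto simp: xn1_factorization_def)
      then show ?thesis using irreducible_dvd_if_root[of p "\<alpha> j" R] 1 \<alpha> R by auto
    next
      case (2 j)
      then have j: "j \<in> {1..r+s}" by auto
      have irr: "irreducible p" using 2 fact by (auto simp: xn1_factorization_def)
      then have "reflect_poly (f j) \<noteq> 0" using 2 by (auto simp: make_monic_def)
      then have "lead_coeff p = 1" using 2 by (simp add: make_monic_def)
      moreover have "ac_eval p (inverse (\<alpha> j)) = 0"
        using ac_eval_reflect_inverse[of "f j" "\<alpha> j"] \<alpha> j nz[OF j] 2 by (simp add: make_monic_def)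
      ultimately show ?thesis using irr irreducible_dvd_if_root R(2)[OF j] by blast
    qed
  qed
  moreover have "prod_list ?ps = monom 1 n - 1"
  proof -
    have prod_list: "prod_list (map g [a..<b + 1]) = (\<Prod>j\<in>{a..b}. g j)"
      for g :: "nat \<Rightarrow> 'a poly" and a b
      using prod.distinct_set_conv_list[of "[a..<b + 1]" g]
      by (simp add: atLeastLessThanSuc_atLeastAtMost del: upt_Suc)
    have "prod_list ?ps = (\<Prod>j\<in>{1..r+s}. f j) * (\<Prod>j\<in>{r+1..r+s}. ?f' j)"
      unfolding prod_list.append prod_list ..
    also have "(\<Prod>j\<in>{1..r+s}. f j) = (\<Prod>j\<in>{1..r}. f j) * (\<Prod>j\<in>{r+1..r+s}. f j)"
      by (rule prod.ub_add_nat) simp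
    also have "\<dots> * (\<Prod>j\<in>{r+1..r+s}. ?f' j) =
        (\<Prod>j\<in>{1..r}. f j) * (\<Prod>j\<in>{r+1..r+s}. f j * ?f' j)"
      by (simp only: prod.distrib mult.assoc)
    also have "\<dots> = monom 1 n - 1" using fact unfolding xn1_factorization_def by metis
    finally show ?thesis .
  qed
  moreover have "degree (monom 1 n - 1 :: 'a poly) = n"
    using degree_add_eq_left[of "- 1" "monom (1::'a) n"] n by (simp add: degree_monom_eq)
  moreover have "degree R < n"
    unfolding R_def P'_def P_poly_def Q_poly_def
    by (intro degree_diff_less degree_sum_less n) (auto intro: le_less_trans[OF degree_monom_le])
  ultimately have "R = 0" using dvd_imp_degree_le[of "monom 1 n - 1" R] by fastforce
  have "coeff R (nat i) = u (True, i) - u (False, (- i) mod int n)"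
    using i by (simp add: R_def P'_def P_poly_def Q_poly_def coeff_sum coeff_monom nat_less_iff)
  then show ?thesis using \<open>R = 0\<close> by simp
qed

lemma factor_root_power_eq_1:
  assumes fact: "xn1_factorization n f r s" and j: "j \<in> {1..r+s}"
    and root: "ac_eval (f j) x = 0"
  shows "x ^ n = 1"
proof -
  have "f j dvd (\<Prod>j\<in>{1..r}. f j) * (\<Prod>j\<in>{r+1..r+s}. f j * make_monic (reflect_poly (f j)))"
  proof (cases "j \<le> r")
    case True
    then show ?thesis using j by (intro dvd_mult2 dvd_prodI) auto
  next
    case False
    then have "f j * make_monic (reflect_poly (f j)) dvd
        (\<Prod>j\<in>{r+1..r+s}. f j * make_monic (reflect_poly (f j)))"
      using j by (intro dvd_prodI) auto
    then show ?thesis by (intro dvd_mult) (rule dvd_mult_left)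
  qed
  also have "\<dots> = monom 1 n - 1" using fact unfolding xn1_factorization_def by metis
  finally obtain k where "monom 1 n - 1 = f j * k" ..
  then have "ac_eval (monom 1 n - 1) x = 0" using root by (metis ac_eval_mult mult_zero_left)
  then show ?thesis by simp
qed

text \<open>Otherwise \<open>x\<close> would be \<open>1\<close> or \<open>-1\<close>, the root of \<open>f\<^sub>1 = x - 1\<close> or (for even \<open>n\<close>) of \<open>f\<^sub>2 = x + 1\<close>,
  and \<open>f\<^sub>j\<close> would equal one of these two factors. For odd \<open>n\<close>, \<open>x = -1\<close> and \<open>x\<^sup>n = 1\<close> give \<open>x = 1\<close>.\<close>
lemma factor_root_neq_inverse:
  fixes f :: "nat \<Rightarrow> 'a::field poly"
  assumes fact: "xn1_factorization n f r s" and j: "j \<in> {zeta n + 1..r}"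
    and root: "ac_eval (f j) x = 0" and "n > 0"
  shows "x \<noteq> inverse x"
proof
  assume eq: "x = inverse x"
  have xn: "x ^ n = 1" using factor_root_power_eq_1[OF fact _ root] j by auto
  then have "x \<noteq> 0" using \<open>n > 0\<close> by (metis power_0_left zero_neq_one not_gr_zero)
  then have "x * x = 1" using eq by (metis right_inverse)
  then have pm: "x = 1 \<or> x = - 1" by (simp add: square_eq_1_iff)
  have zeta: "zeta n \<ge> 1" by (simp add: zeta_def)
  have irr: "irreducible (f i) \<and> lead_coeff (f i) = 1" if "i \<in> {1..r}" for i
    using fact that by (auto simp: xn1_factorization_def)
  have no_common_root: "ac_eval (f i) x \<noteq> 0" if "i \<in> {1..r}" "i \<noteq> j" for i
  proof
    assume "ac_eval (f i) x = 0"
    moreover have jr: "j \<in> {1..r}" using j zeta by auto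
    ultimately have "f i = f j"
      using irr[OF that(1)] irr[OF jr] root monic_irreducible_dvd_imp_eq irreducible_dvd_if_root by metis
    moreover have "inj_on f {1..r+s}"
      using fact by (simp add: xn1_factorization_def distinct_map atLeastLessThanSuc_atLeastAtMost del: upt_Suc)
    ultimately show False using that jr by (auto dest!: inj_onD)
  qed
  have x1: "x \<noteq> 1"
  proof
    assume "x = 1"
    moreover have "f 1 = [:-1, 1:]" using fact by (simp add: xn1_factorization_def)
    ultimately show False using no_common_root[of 1] j zeta by (auto simp: ac_eval_pCons)
  qed
  with pm have x: "x = - 1" by simp
  show False
  proof (cases "even n")
    case True
    then have "f 2 = [:1, 1:]" "zeta n = 2" using fact by (auto simp: xn1_factorization_def zeta_def)
    then show False using no_common_root[of 2] j x by (auto simp: ac_eval_pCons)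
  next
    case False
    then show False using xn x x1 by simp
  qed
qed

theorem theorem11:
  fixes n r s :: nat
    and f :: "nat \<Rightarrow> 'a::{field, finite} poly"
    and \<alpha> :: "nat \<Rightarrow> 'a alg_closure"
    and K :: "nat set"
    and C :: "(bool \<times> int \<Rightarrow> 'a) set"
  assumes "n \<ge> 2"
    and "coprime CARD('a) n"
    and "xn1_factorization n f r s"
    and "\<forall>j\<in>{1..r+s}. ac_eval (f j) (\<alpha> j) = 0"
    and "K \<noteq> {}"
    and "K \<subseteq> {1..r+s}"
    and "left_ideal C (dihedral_algebra n)"
    and "decomp n r s \<alpha> ` C =
      (\<Pi>\<^sub>E j\<in>{1..r+s}.
         if j \<le> zeta n then Inl ` (if j \<in> K then I_C2 1 0 else {\<zero>\<^bsub>C2_algebra\<^esub>})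
         else Inr ` (if j \<notin> K then {0}
           else if j \<le> r then I_mat (F_field r \<alpha> j) (\<alpha> j + inverse (\<alpha> j)) 2
           else I_mat (F_field r \<alpha> j) (- 1) 1))"
  shows "min_distance C = 2 * min_distance (exterior_code n C)"
proof -
  have n: "n > 0" using assms(1) by simp
  note fact = assms(3)
  define I where "I = {1..r+s}"
  define S where "S = (\<lambda>j. if j \<le> zeta n then Inl ` (if j \<in> K then (I_C2 1 0 :: (int \<Rightarrow> 'a) set) else {\<zero>\<^bsub>C2_algebra\<^esub>})
         else Inr ` (if j \<notin> K then {0}
           else if j \<le> r then I_mat (F_field r \<alpha> j) (\<alpha> j + inverse (\<alpha> j)) 2
           else I_mat (F_field r \<alpha> j) (- 1) 1))"
  have image: "decomp n r s \<alpha> ` C = Pi\<^sub>E I S" using assms(8) by (simp add: S_def I_def)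
  have zeta: "zeta n \<ge> 1" "zeta n \<le> r" using fact by (auto simp: zeta_def xn1_factorization_def)
  have \<alpha>n: "\<alpha> j ^ n = 1" if "j \<in> I" for j
    using factor_root_power_eq_1[OF fact, of j "\<alpha> j"] that assms(4) by (simp add: I_def)
  have \<alpha>0: "\<alpha> j \<noteq> 0" if "j \<in> I" for j
    using \<alpha>n[OF that] n by (metis power_0_left zero_neq_one not_gr_zero)
  have \<alpha>inv: "\<alpha> j \<noteq> inverse (\<alpha> j)" if "zeta n < j" "j \<le> r" for j
    using factor_root_neq_inverse[OF fact _ _ n, of j "\<alpha> j"] that assms(4) by auto
  have C2_zero: "\<zero>\<^bsub>C2_algebra\<^esub> = C2_elem 0 (0::'a)"
    by (auto simp: C2_algebra_def group_algebra_def C2_elem_def)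
  have I_mat_zero: "0 \<in> I_mat (F_field r \<alpha> j) x y" for j x y
  proof -
    have "0 = mat2 (0 * y) (- (0 * x)) (0 * y) (- (0 * x))" by (simp add: vec_eq_iff forall_2)
    then show ?thesis using zero_one_mem_F_field(1)[of r \<alpha> j] unfolding I_mat_def by blast
  qed
  have \<alpha>_small: "\<alpha> j = to_ac (if j = 1 then 1 else - 1)" if "j \<in> I" "j \<le> zeta n" for j
  proof (cases "j = 1")
    case True
    have "f 1 = [:-1, 1:]" using fact by (simp add: xn1_factorization_def)
    moreover have "ac_eval (f 1) (\<alpha> 1) = 0" using assms(4) that True by (simp add: I_def)
    ultimately show ?thesis using True by (simp add: ac_eval_pCons)
  next
    case False
    then have "j = 2" "even n" using that by (auto simp: I_def zeta_def split: if_splits)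
    moreover have "f 2 = [:1, 1:]" using fact \<open>even n\<close> by (simp add: xn1_factorization_def)
    moreover have "ac_eval (f j) (\<alpha> j) = 0" using assms(4) that by (simp add: I_def)
    ultimately have "ac_eval [:1, 1:] (\<alpha> 2) = 0" by simp
    then show ?thesis using \<open>j = 2\<close> by (simp add: ac_eval_pCons eq_neg_iff_add_eq_0 add.commute)
  qed
  \<comment> \<open>Each prescribed ideal forces \<open>Q(\<alpha>\<^sub>j) = P(\<alpha>\<^sub>j\<^sup>-\<^sup>1)\<close> and \<open>Q(\<alpha>\<^sub>j\<^sup>-\<^sup>1) = P(\<alpha>\<^sub>j)\<close>; so does the zero ideal.\<close>
  have root: "ac_eval (Q_poly n u) (\<alpha> j) = ac_eval (P_poly n u) (inverse (\<alpha> j)) \<and>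
      ac_eval (Q_poly n u) (inverse (\<alpha> j)) = ac_eval (P_poly n u) (\<alpha> j)"
    if u: "u \<in> C" and j: "j \<in> I" for u j
  proof -
    let ?P = "P_poly n u" and ?Q = "Q_poly n u"
    have "decomp n r s \<alpha> u \<in> Pi\<^sub>E I S" using image u by blast
    then have "decomp n r s \<alpha> u j \<in> S j" using j by (rule PiE_mem)
    then have mem: "decomp_comp n r \<alpha> j u \<in> S j" using j by (simp add: decomp_def I_def)
    consider "j \<le> zeta n" | "zeta n < j" "j \<le> r" | "r < j" by linarith
    then show ?thesis
    proof cases
      case 1
      define c where "c = (if j = 1 then 1 else - 1 :: 'a)"
      have "decomp_comp n r \<alpha> j u = Inl (C2_elem (poly ?P c) (poly ?Q c))"
        using 1 by (simp add: decomp_comp_def c_def)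
      then have "C2_elem (poly ?P c) (poly ?Q c) \<in> I_C2 1 0 \<or>
          C2_elem (poly ?P c) (poly ?Q c) = C2_elem 0 0"
        using mem 1 by (auto simp: S_def C2_zero split: if_splits)
      then have "poly ?P c = poly ?Q c"
        using C2_elem_mem_I_C2_imp_eq by (auto simp: C2_elem_def fun_eq_iff split: if_splits)
      moreover have "\<alpha> j = to_ac c" "inverse (\<alpha> j) = to_ac c"
        using \<alpha>_small[OF j 1] by (simp_all add: c_def)
      ultimately show ?thesis by (simp add: ac_eval_to_ac)
    next
      case 2
      then have "sigma (\<alpha> j) (tau n (\<alpha> j) u) \<in> I_mat (F_field r \<alpha> j) (\<alpha> j + inverse (\<alpha> j)) 2"
        using mem zeta(1) I_mat_zero by (auto simp: S_def decomp_comp_def split: if_splits)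
      then show ?thesis
        using sigma_mem_I_mat_imp_equal_columns \<alpha>0[OF j] \<alpha>inv[OF 2] unfolding tau_def by metis
    next
      case 3
      then have "tau n (\<alpha> j) u \<in> I_mat (F_field r \<alpha> j) (- 1) 1"
        using mem zeta I_mat_zero by (auto simp: S_def decomp_comp_def split: if_splits)
      then show ?thesis by (auto simp: I_mat_def tau_def mat2_eq_iff)
    qed
  qed
  have "\<exists>c\<in>C. c \<noteq> (\<lambda>g. 0)"
  proof -
    obtain j where j: "j \<in> K" using assms(5) by blast
    \<comment> \<open>In characteristic 2 a vanishing sum would mean \<open>\<alpha>\<^sub>j = \<alpha>\<^sub>j\<^sup>-\<^sup>1\<close>.\<close>
    have "\<alpha> j + inverse (\<alpha> j) \<noteq> 0 \<or> (2 :: 'a alg_closure) \<noteq> 0" if "zeta n < j" "j \<le> r"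
      using \<alpha>inv[OF that] by (metis add_eq_0_iff mult_2 mult_zero_left neg_eq_iff_add_eq_0 add_cancel_right_right)
    then have "\<exists>v\<in>S j. \<exists>w\<in>S j. v \<noteq> w"
      using j I_C2_nontrivial[where 'a = 'a]
        I_mat_nontrivial[OF zero_one_mem_F_field, of "\<alpha> j + inverse (\<alpha> j)" 2 r \<alpha> j]
        I_mat_nontrivial[OF zero_one_mem_F_field, of "- 1" 1 r \<alpha> j]
      by (auto simp: S_def)
    then obtain v w where vw: "v \<in> S j" "w \<in> S j" "v \<noteq> w" by blast
    have ne: "S i \<noteq> {}" for i
      using I_C2_nontrivial[where 'a = 'a] zero_one_mem_F_field[of r \<alpha> i] by (auto simp: S_def I_mat_def)
    show ?thesis
      using ex_neq_if_image_eq_PiE[OF image ne _ vw] j assms(6) by (auto simp: I_def)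
  qed
  moreover have "u (True, i) = u (False, (- i) mod int n)" if "u \<in> C" "i \<in> {0..<int n}" for u i
    using coeffs_symmetric_if_factor_roots[OF n fact assms(4) _ _ that(2)] root[OF that(1)] \<alpha>n unfolding I_def by blast
  ultimately show ?thesis by (intro min_distance_symmetric_code[OF n assms(7)])
qed

end
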